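(* Let $n\ge4$ and let $\lambda=\lambda_{2,n}$ be the lifting function on the vertices of $\Delta(2,n)$ with $\lambda(v_i)=1$ for $1\le i\le n-2$ and $\lambda(v_i)=0$ otherwise, where $v_1,\dots,v_{\binom n2}$ are the vertices of $\Delta(2,n)$ in descending lexicographic order. Then the regular subdivision $\Delta(2,n)^\lambda$ is a non-matroidal coarsest subdivision of spread $n$.
   Context: The hypersimplex $\Delta(k,n)=\operatorname{conv}\{e_X : X\subseteq[n],\ |X|=k\}\subset\mathbb{R}^n$ with $e_X=\sum_{i\in X}e_i$; vertices are ordered in descending lexicographic order as 0/1-vectors (e.g., for $\Delta(2,4)$: $1100,1010,1001,0110,0101,0011$). A lifting function $\omega$ induces the regular subdivision $\Delta(k,n)^\omega$, whose cells are the projections (omitting the last coordinate) of the lower faces of $\operatorname{conv}\{(v,\omega(v))\}$, i.e., faces with an outer normal having negative last coordinate. The spread is the number of maximal cells. A regular subdivision is coarsest if its secondary cone (the closure of the set of lifting functions inducing it) is a ray modulo the lineality space of the secondary fan; equivalently it is nontrivial and the only regular subdivisions it refines are itself and the trivial one. A subdivision is non-matroidal if some cell is not a matroid polytope, a matroid polytope being a 0/1-polytope all of whose edges are parallel to vectors $e_i-e_j$.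
   Formalization: "Coarsest" is asserted only for n ≥ 5: for n = 4 the subdivision is a triangulation of the octahedron into four tetrahedra that properly refines a split, so it is not coarsest. "Non-matroidal" and "spread n" are stated for all n ≥ 4. *)

theory Defs
  imports "HOL-Analysis.Analysis"
begin

text \<open>
  The ground set \<open>[n]\<close> is a finite linearly ordered type \<open>'n\<close> with \<open>CARD('n) = n\<close>; the order is
  only needed for the lexicographic order on vectors.
\<close>

definition char_vec :: "'n set \<Rightarrow> real ^ 'n" where
  "char_vec X = (\<Sum>i\<in>X. axis i 1)"

definition hypersimplex :: "nat \<Rightarrow> (real ^ 'n) set" where
  "hypersimplex k = convex hull {char_vec X | X. card X = k}"

definition vertices :: "'a::euclidean_space set \<Rightarrow> 'a set" where
  "vertices P = {v. v extreme_point_of P}"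

definition lex_less :: "real ^ ('n::{finite,linorder}) \<Rightarrow> real ^ ('n::{finite,linorder}) \<Rightarrow> bool" where
  "lex_less x y \<longleftrightarrow> (\<exists>i. x $ i < y $ i \<and> (\<forall>j<i. x $ j = y $ j))"


subsection \<open>Regular subdivisions\<close>

definition lower_face_of :: "('a::euclidean_space \<times> real) set \<Rightarrow> ('a \<times> real) set \<Rightarrow> bool"
    (infixr "lower'_face'_of" 50) where
  "F lower_face_of Q \<longleftrightarrow>
     F \<noteq> {} \<and> (\<exists>a b. snd a < 0 \<and> Q \<subseteq> {z. a \<bullet> z \<le> b} \<and> F = Q \<inter> {z. a \<bullet> z = b})"

text \<open>The set of all nonempty cells, of every dimension.\<close>

definition regular_subdivision ::
    "'a::euclidean_space set \<Rightarrow> ('a \<Rightarrow> real) \<Rightarrow> 'a set set" where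
  "regular_subdivision P \<omega> =
     {fst ` F | F. F lower_face_of (convex hull ((\<lambda>v. (v, \<omega> v)) ` vertices P))}"

definition maximal_cells :: "'a set set \<Rightarrow> 'a set set" where
  "maximal_cells S = {C \<in> S. \<forall>D\<in>S. C \<subseteq> D \<longrightarrow> C = D}"

definition spread :: "'a set set \<Rightarrow> nat" where
  "spread S = card (maximal_cells S)"


subsection \<open>Secondary cones\<close>

text \<open>
  The space of lifting functions on the vertices of \<open>P\<close> is realised as the functions vanishing
  off the vertices, a closed linear subspace of \<open>'a \<Rightarrow> real\<close> with the product topology. For a
  polytope \<open>P\<close> it is finite-dimensional, with its usual topology.
\<close>

definition lifting_functions :: "'a::euclidean_space set \<Rightarrow> ('a \<Rightarrow> real) set" where
  "lifting_functions P = {\<omega>. \<forall>x. x \<notin> vertices P \<longrightarrow> \<omega> x = 0}"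

definition secondary_cone ::
    "'a::euclidean_space set \<Rightarrow> 'a set set \<Rightarrow> ('a \<Rightarrow> real) set" where
  "secondary_cone P S = closure {\<omega> \<in> lifting_functions P. regular_subdivision P \<omega> = S}"

text \<open>
  The cones of the secondary fan are the secondary cones of the regular subdivisions. The largest
  linear subspace contained in a convex cone \<open>C\<close> is the intersection of \<open>C\<close> and \<open>- C\<close>.
\<close>

definition secondary_lineality :: "'a::euclidean_space set \<Rightarrow> ('a \<Rightarrow> real) set" where
  "secondary_lineality P =
     {l. \<forall>\<omega>. l \<in> secondary_cone P (regular_subdivision P \<omega>) \<and>
             (\<lambda>x. - l x) \<in> secondary_cone P (regular_subdivision P \<omega>)}"

definition coarsest_subdivision :: "'a::euclidean_space set \<Rightarrow> 'a set set \<Rightarrow> bool" where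
  "coarsest_subdivision P S \<longleftrightarrow>
     (\<exists>r\<in>lifting_functions P. r \<notin> secondary_lineality P \<and>
        secondary_cone P S = {\<lambda>x. t * r x + l x | t l. 0 \<le> t \<and> l \<in> secondary_lineality P})"


subsection \<open>Matroid polytopes\<close>

definition zero_one_polytope :: "(real ^ 'n) set \<Rightarrow> bool" where
  "zero_one_polytope P \<longleftrightarrow> (\<exists>V. (\<forall>v\<in>V. \<forall>i. v $ i \<in> {0, 1}) \<and> P = convex hull V)"

definition matroid_polytope :: "(real ^ 'n) set \<Rightarrow> bool" where
  "matroid_polytope P \<longleftrightarrow> zero_one_polytope P \<and>
     (\<forall>E. E edge_of P \<longrightarrow>
        (\<exists>i j. i \<noteq> j \<and> (\<forall>x\<in>E. \<forall>y\<in>E. \<exists>c. x - y = c *\<^sub>R (axis i 1 - axis j 1))))"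

definition non_matroidal :: "(real ^ 'n) set set \<Rightarrow> bool" where
  "non_matroidal S \<longleftrightarrow> (\<exists>C\<in>S. \<not> matroid_polytope C)"

end

theory Submission
  imports Defs
begin

text \<open>
  The nonempty cells of the subdivision induced by \<open>w\<close> correspond to the sets of edges of the
  complete graph on \<open>[n]\<close> on which \<open>y\<^sub>i + y\<^sub>j \<le> w\<^sub>i\<^sub>j\<close> is tight, for some \<open>y\<close> satisfying all these
  inequalities. Let \<open>a\<close> and \<open>z\<close> be the first and the last element. Then \<open>\<lambda>\<close> is the indicator of the
  edges \<open>{a, i}\<close> with \<open>i \<noteq> z\<close>, and the maximal tight sets are the two pyramids consisting of
  \<open>{a, z}\<close> and all edges avoiding \<open>a\<close>, respectively \<open>z\<close>, and, for each \<open>i \<noteq> a, z\<close>, the star of \<open>i\<close>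
  together with \<open>{a, z}\<close>. The segment from the apex of a pyramid to a base vertex disjoint from it
  is an edge that no matroid polytope has.

  If both pyramids are cells for \<open>w\<close>, subtract a linear function so that \<open>w\<close> vanishes on the first.
  On the second \<open>w\<close> is given by some \<open>y\<close> with \<open>y\<^sub>j + y\<^sub>k = 0\<close> for all \<open>j, k\<close> other than \<open>a, z\<close>; for
  \<open>n \<ge> 5\<close> there are three such elements, so these \<open>y\<^sub>j\<close> vanish and \<open>w = y\<^sub>a \<lambda>\<close>.
\<close>

section \<open>Lower faces as contact sets of affine minorants\<close>

text \<open>Every face of a polytope is the hull of some of its generators, and these must lie on
  the hyperplane.\<close>

lemma convex_hull_Int_supporting_hyperplane:
  fixes V :: "'a::euclidean_space set"
  assumes "finite V" and le: "\<And>v. v \<in> V \<Longrightarrow> c \<bullet> v \<le> b"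
  shows "convex hull V \<inter> {x. c \<bullet> x = b} = convex hull {v \<in> V. c \<bullet> v = b}"
    and "(convex hull V \<inter> {x. c \<bullet> x = b}) face_of (convex hull V)"
proof -
  have "convex hull V \<subseteq> {x. c \<bullet> x \<le> b}"
    by (rule hull_minimal) (auto simp: le convex_halfspace_le)
  then show face: "(convex hull V \<inter> {x. c \<bullet> x = b}) face_of (convex hull V)"
    by (intro face_of_Int_supporting_hyperplane_le) auto
  then obtain S where S: "S \<subseteq> V" "convex hull V \<inter> {x. c \<bullet> x = b} = convex hull S"
    using face_of_convex_hull_subset[OF finite_imp_compact[OF \<open>finite V\<close>]] by metis
  then have "S \<subseteq> {v \<in> V. c \<bullet> v = b}"
    using hull_subset[of S convex] by auto
  then have "convex hull S \<subseteq> convex hull {v \<in> V. c \<bullet> v = b}"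
    by (rule hull_mono)
  moreover have "convex hull {v \<in> V. c \<bullet> v = b} \<subseteq> convex hull V \<inter> {x. c \<bullet> x = b}"
    by (rule hull_minimal)
      (auto intro: hull_inc convex_Int convex_convex_hull convex_hyperplane)
  ultimately show "convex hull V \<inter> {x. c \<bullet> x = b} = convex hull {v \<in> V. c \<bullet> v = b}"
    using S(2) by auto
qed

text \<open>An outer normal with negative last coordinate can be scaled to last coordinate -1. Its
  other coordinates are then the gradient of an affine function below \<open>w\<close>, and the face
  projects to the hull of the vertices where this function touches \<open>w\<close>.\<close>

lemma regular_subdivision_eq:
  fixes P :: "'a::euclidean_space set"
  assumes fin: "finite (vertices P)"
  shows "regular_subdivision P w =
    {convex hull {v \<in> vertices P. c \<bullet> v + d = w v} | c d.
       (\<forall>v\<in>vertices P. c \<bullet> v + d \<le> w v) \<and> (\<exists>v\<in>vertices P. c \<bullet> v + d = w v)}"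
    (is "?L = ?R")
proof -
  let ?lift = "\<lambda>v. (v, w v)"
  let ?Q = "convex hull (?lift ` vertices P)"
  have cell: "fst ` (?Q \<inter> {x. a \<bullet> x = b}) = convex hull {v \<in> vertices P. a \<bullet> ?lift v = b}"
    if "\<And>v. v \<in> vertices P \<Longrightarrow> a \<bullet> ?lift v \<le> b" for a b
  proof -
    have "?Q \<inter> {x. a \<bullet> x = b} = convex hull {x \<in> ?lift ` vertices P. a \<bullet> x = b}"
      using fin that by (intro convex_hull_Int_supporting_hyperplane) auto
    then have "fst ` (?Q \<inter> {x. a \<bullet> x = b}) =
        convex hull (fst ` {x \<in> ?lift ` vertices P. a \<bullet> x = b})"
      by (simp add: convex_hull_linear_image linear_fst)
    also have "fst ` {x \<in> ?lift ` vertices P. a \<bullet> x = b} = {v \<in> vertices P. a \<bullet> ?lift v = b}"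
      by force
    finally show ?thesis .
  qed
  show ?thesis
  proof (intro equalityI subsetI)
    fix C assume "C \<in> ?L"
    then obtain F where "F lower_face_of ?Q" and C: "C = fst ` F"
      unfolding regular_subdivision_def by blast
    then obtain a b where F: "F \<noteq> {}" "snd a < 0" "?Q \<subseteq> {z. a \<bullet> z \<le> b}"
      "F = ?Q \<inter> {z. a \<bullet> z = b}"
      unfolding lower_face_of_def by (elim conjE exE)
    define c where "c = (1 / - snd a) *\<^sub>R fst a"
    define d where "d = b / snd a"
    have eq: "a \<bullet> ?lift v - b = - snd a * (c \<bullet> v + d - w v)" for v
    proof -
      have "a \<bullet> ?lift v = fst a \<bullet> v + snd a * w v"
        by (cases a) simp
      moreover have "snd a * (c \<bullet> v) = - (fst a \<bullet> v)" "snd a * d = b"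
        using \<open>snd a < 0\<close> by (simp_all add: c_def d_def)
      ultimately show ?thesis
        by (simp add: algebra_simps)
    qed
    have le: "a \<bullet> ?lift v \<le> b" if "v \<in> vertices P" for v
      using F(3) hull_inc[of "?lift v" "?lift ` vertices P" convex] that by blast
    have eq0: "a \<bullet> ?lift v = b \<longleftrightarrow> c \<bullet> v + d = w v" for v
      using eq[of v] \<open>snd a < 0\<close> by (smt (verit) mult_eq_0_iff)
    have le0: "c \<bullet> v + d \<le> w v" if "v \<in> vertices P" for v
      using eq[of v] le[OF that] \<open>snd a < 0\<close> by (smt (verit) mult_pos_pos)
    have "C = convex hull {v \<in> vertices P. c \<bullet> v + d = w v}"
      using cell[OF le] F C by (simp add: eq0)
    moreover have "C \<noteq> {}"
      using F C by simp
    ultimately have "\<exists>v\<in>vertices P. c \<bullet> v + d = w v"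
      by auto
    with le0 \<open>C = convex hull {v \<in> vertices P. c \<bullet> v + d = w v}\<close> show "C \<in> ?R"
      by auto
  next
    fix C assume "C \<in> ?R"
    then obtain c d where C: "C = convex hull {v \<in> vertices P. c \<bullet> v + d = w v}"
      "\<forall>v\<in>vertices P. c \<bullet> v + d \<le> w v" "\<exists>v\<in>vertices P. c \<bullet> v + d = w v"
      by blast
    let ?a = "(c, -1 :: real)"
    have le: "?a \<bullet> ?lift v \<le> - d" if "v \<in> vertices P" for v
      using C(2) that by (force simp: algebra_simps)
    have "C = fst ` (?Q \<inter> {z. ?a \<bullet> z = - d})"
      using cell[OF le] C by (simp add: algebra_simps)
    moreover have "?Q \<subseteq> {z. ?a \<bullet> z \<le> - d}"
      by (rule hull_minimal) (use le in \<open>auto simp: convex_halfspace_le\<close>)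
    moreover have "C \<noteq> {}"
      using C by auto
    ultimately show "C \<in> ?L"
      unfolding regular_subdivision_def lower_face_of_def
      by (intro CollectI exI[of _ "?Q \<inter> {z. ?a \<bullet> z = - d}"] conjI exI[of _ ?a] exI[of _ "- d"]) auto
  qed
qed

section \<open>Vertices of the hypersimplex\<close>

lemma char_vec_nth: "char_vec X $ i = (if i \<in> X then 1 else 0)"
  by (simp add: char_vec_def axis_def sum.If_cases)

lemma char_vec_eq_iff [simp]: "char_vec X = char_vec Y \<longleftrightarrow> X = Y"
  by (auto simp: vec_eq_iff char_vec_nth split: if_splits)

lemma inner_char_vec: "c \<bullet> char_vec X = (\<Sum>i\<in>X. c $ i)"
  by (simp add: char_vec_def inner_sum_right inner_axis)

text \<open>The functional \<open>char_vec X\<close> counts common elements with \<open>X\<close>: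
  it is \<open>k\<close> at \<open>X\<close> and at most \<open>k - 1\<close> at any other
  \<open>k\<close>-set, so it separates \<open>X\<close> from a family omitting it.\<close>

lemma convex_independent_char_vec:
  assumes "\<And>Y. Y \<in> T \<Longrightarrow> card Y = k" "card X = k" "char_vec X \<in> convex hull (char_vec ` T)"
  shows "X \<in> T"
proof (rule ccontr)
  assume "X \<notin> T"
  have "card (Y \<inter> X) \<le> real k - 1" if "Y \<in> T" for Y
  proof -
    have "Y \<inter> X \<subset> X"
      using that \<open>X \<notin> T\<close> assms by (metis card_subset_eq finite inf.absorb_iff2 inf_le2 psubsetI)
    then have "card (Y \<inter> X) < card X"
      by (simp add: psubset_card_mono)
    then show ?thesis
      using assms(2) by simp
  qed
  then have "char_vec ` T \<subseteq> {x. char_vec X \<bullet> x \<le> real k - 1}"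
    by (auto simp: inner_char_vec char_vec_nth sum.If_cases)
  then have "convex hull (char_vec ` T) \<subseteq> {x. char_vec X \<bullet> x \<le> real k - 1}"
    by (rule hull_minimal) (simp add: convex_halfspace_le)
  moreover have "char_vec X \<bullet> char_vec X = real k"
    by (simp add: inner_char_vec char_vec_nth assms(2))
  ultimately show False
    using assms(3) by auto
qed

lemma vertices_hypersimplex: "vertices (hypersimplex k) = char_vec ` {X. card X = k}"
proof -
  have "char_vec X \<notin> convex hull (char_vec ` {X. card X = k} - {char_vec X})"
    if "card X = k" for X :: "'a set"
  proof -
    have "char_vec ` {X. card X = k} - {char_vec X} = char_vec ` ({X. card X = k} - {X})"
      by auto
    then show ?thesis
      using convex_independent_char_vec[of "{X. card X = k} - {X}" k X] that by fastforce
  qed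
  then have "x extreme_point_of (convex hull (char_vec ` {X. card X = k})) \<longleftrightarrow>
      x \<in> char_vec ` {X. card X = k}" for x :: "real ^ 'a"
    by (intro extreme_point_of_convex_hull_convex_independent)
      (auto simp del: image_Collect intro: finite_imp_compact)
  then show ?thesis
    unfolding vertices_def hypersimplex_def setcompr_eq_image by blast
qed

section \<open>Cells of \<open>hypersimplex 2\<close> as sets of edges\<close>

definition subordinate :: "('n set \<Rightarrow> real) \<Rightarrow> ('n \<Rightarrow> real) \<Rightarrow> bool" where
  "subordinate w y \<longleftrightarrow> (\<forall>X. card X = 2 \<longrightarrow> sum y X \<le> w X)"

definition tight :: "('n set \<Rightarrow> real) \<Rightarrow> ('n \<Rightarrow> real) \<Rightarrow> 'n set set" where
  "tight w y = {X. card X = 2 \<and> sum y X = w X}"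

text \<open>The empty contact set is excluded because cells come from nonempty faces.\<close>

definition tight_sets :: "('n set \<Rightarrow> real) \<Rightarrow> 'n set set set" where
  "tight_sets w = {tight w y | y. subordinate w y \<and> tight w y \<noteq> {}}"

definition cell :: "'n set set \<Rightarrow> (real ^ 'n) set" where
  "cell T = convex hull (char_vec ` T)"

lemma tight_setsI: "subordinate w y \<Longrightarrow> tight w y = T \<Longrightarrow> T \<noteq> {} \<Longrightarrow> T \<in> tight_sets w"
  unfolding tight_sets_def by blast

lemma tight_sets_card: "T \<in> tight_sets w \<Longrightarrow> X \<in> T \<Longrightarrow> card X = 2"
  by (auto simp: tight_sets_def tight_def)

text \<open>On \<open>\<Delta>(2,n)\<close> the coordinates add up to 2, so affine functions can be taken linear.\<close>

lemma regular_subdivision_hypersimplex: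
  "regular_subdivision (hypersimplex 2) w = cell ` tight_sets (w \<circ> char_vec)"
    (is "?L = ?R")
proof -
  have fin: "finite (vertices (hypersimplex 2) :: (real ^ 'a) set)"
    by (simp add: vertices_hypersimplex)
  have cell: "convex hull {v \<in> vertices (hypersimplex 2). c \<bullet> v + d = w v} = cell (tight (w \<circ> char_vec) y)"
    if "\<And>X. card X = 2 \<Longrightarrow> c \<bullet> char_vec X + d = sum y X" for c d y
  proof -
    have "{v \<in> vertices (hypersimplex 2). c \<bullet> v + d = w v} = char_vec ` tight (w \<circ> char_vec) y"
      using that by (auto simp: vertices_hypersimplex tight_def)
    then show ?thesis
      by (simp add: cell_def)
  qed
  show ?thesis
  proof (intro equalityI subsetI)
    fix C assume "C \<in> ?L"
    then obtain c d where C: "C = convex hull {v \<in> vertices (hypersimplex 2). c \<bullet> v + d = w v}"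
      "\<forall>v\<in>vertices (hypersimplex 2). c \<bullet> v + d \<le> w v"
      "\<exists>v\<in>vertices (hypersimplex 2). c \<bullet> v + d = w v"
      unfolding regular_subdivision_eq[OF fin] by blast
    define y where "y i = c $ i + d / 2" for i
    have y: "c \<bullet> char_vec X + d = sum y X" if "card X = 2" for X
      using that by (simp add: y_def inner_char_vec sum.distrib)
    have "C = cell (tight (w \<circ> char_vec) y)"
      using cell[OF y] C(1) by simp
    moreover have "tight (w \<circ> char_vec) y \<in> tight_sets (w \<circ> char_vec)"
      using C(2,3) y by (intro tight_setsI[of _ y])
        (auto simp: vertices_hypersimplex subordinate_def tight_def)
    ultimately show "C \<in> ?R"
      by blast
  next
    fix C assume "C \<in> ?R"
    then obtain y where C: "C = cell (tight (w \<circ> char_vec) y)" "subordinate (w \<circ> char_vec) y"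
      "tight (w \<circ> char_vec) y \<noteq> {}"
      by (auto simp: tight_sets_def)
    define c where "c = (\<chi> i. y i)"
    have y: "c \<bullet> char_vec X + 0 = sum y X" if "card X = 2" for X
      by (simp add: c_def inner_char_vec)
    have "C = convex hull {v \<in> vertices (hypersimplex 2). c \<bullet> v + 0 = w v}"
      using cell[OF y] C(1) by simp
    moreover have "\<forall>v\<in>vertices (hypersimplex 2). c \<bullet> v + 0 \<le> w v"
      "\<exists>v\<in>vertices (hypersimplex 2). c \<bullet> v + 0 = w v"
      using C(2,3) y by (auto simp: vertices_hypersimplex subordinate_def tight_def)
    ultimately show "C \<in> ?L"
      unfolding regular_subdivision_eq[OF fin] by blast
  qed
qed

text \<open>By convex independence of the vertices a cell determines its edge set, so subdivisions
  can be compared combinatorially.\<close>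

lemma cell_mono_iff:
  assumes "T \<in> tight_sets w" "T' \<in> tight_sets w'"
  shows "cell T \<subseteq> cell T' \<longleftrightarrow> T \<subseteq> T'"
proof
  assume sub: "cell T \<subseteq> cell T'"
  show "T \<subseteq> T'"
  proof
    fix X assume "X \<in> T"
    then have "char_vec X \<in> convex hull (char_vec ` T')"
      using sub by (auto simp: cell_def intro: hull_inc)
    then show "X \<in> T'"
      using convex_independent_char_vec tight_sets_card assms \<open>X \<in> T\<close> by metis
  qed
qed (auto simp: cell_def intro!: hull_mono)

lemma cell_eq_iff:
  assumes "T \<in> tight_sets w" "T' \<in> tight_sets w'"
  shows "cell T = cell T' \<longleftrightarrow> T = T'"
  using cell_mono_iff[OF assms] cell_mono_iff[OF assms(2,1)] by blast

lemma regular_subdivision_hypersimplex_eq_iff: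
  "regular_subdivision (hypersimplex 2) w = regular_subdivision (hypersimplex 2) w' \<longleftrightarrow>
     tight_sets (w \<circ> char_vec) = tight_sets (w' \<circ> char_vec)"
proof
  assume eq: "regular_subdivision (hypersimplex 2) w = regular_subdivision (hypersimplex 2) w'"
  have "A \<subseteq> B" if sub: "cell ` A \<subseteq> cell ` B" and AB: "A = tight_sets u" "B = tight_sets u'"
    for A B :: "'a set set set" and u u'
  proof
    fix T assume "T \<in> A"
    then obtain U where "U \<in> B" "cell T = cell U"
      using sub by auto
    then show "T \<in> B"
      using AB \<open>T \<in> A\<close> cell_eq_iff[of T u U u'] by auto
  qed
  then show "tight_sets (w \<circ> char_vec) = tight_sets (w' \<circ> char_vec)"
    using eq unfolding regular_subdivision_hypersimplex by (intro equalityI) (metis order_refl)+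
qed (simp add: regular_subdivision_hypersimplex)

text \<open>An antichain \<open>M\<close> of tight sets that covers all others is the set of maximal
  ones, and \<open>cell\<close> is injective on it.\<close>

lemma spread_eq_card:
  assumes sub: "M \<subseteq> tight_sets (w \<circ> char_vec)"
    and cover: "\<And>T. T \<in> tight_sets (w \<circ> char_vec) \<Longrightarrow> \<exists>U\<in>M. T \<subseteq> U"
    and anti: "\<And>T U. T \<in> M \<Longrightarrow> U \<in> M \<Longrightarrow> T \<subseteq> U \<Longrightarrow> T = U"
  shows "spread (regular_subdivision (hypersimplex 2) w) = card M"
proof -
  have "maximal_cells (regular_subdivision (hypersimplex 2) w) =
      cell ` {T \<in> tight_sets (w \<circ> char_vec). \<forall>U\<in>tight_sets (w \<circ> char_vec). T \<subseteq> U \<longrightarrow> T = U}"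
    unfolding maximal_cells_def regular_subdivision_hypersimplex
    by (auto simp: cell_mono_iff cell_eq_iff)
  also have "{T \<in> tight_sets (w \<circ> char_vec). \<forall>U\<in>tight_sets (w \<circ> char_vec). T \<subseteq> U \<longrightarrow> T = U} = M"
    using assms by (safe; metis subset_iff subset_trans)
  finally have "maximal_cells (regular_subdivision (hypersimplex 2) w) = cell ` M" .
  moreover have "inj_on cell M"
    using sub by (intro inj_onI) (meson cell_eq_iff subsetD)
  ultimately show ?thesis
    by (simp add: spread_def card_image)
qed


lemma subordinate_iff: "subordinate w y \<longleftrightarrow> (\<forall>p q. p \<noteq> q \<longrightarrow> y p + y q \<le> w {p, q})"
proof -
  have "sum y {p, q} = y p + y q" if "p \<noteq> q" for p q
    using that by simp
  then show ?thesis
    unfolding subordinate_def card_2_iff by metis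
qed

lemma pair_in_tight_iff: "{p, q} \<in> tight w y \<longleftrightarrow> p \<noteq> q \<and> y p + y q = w {p, q}"
  by (auto simp: tight_def card_insert_if)

lemma pair_set_subsetI:
  assumes "\<And>X. X \<in> A \<Longrightarrow> card X = 2" "\<And>p q. p \<noteq> q \<Longrightarrow> {p, q} \<in> A \<Longrightarrow> {p, q} \<in> B"
  shows "A \<subseteq> B"
  using assms by (metis card_2_iff subsetI)

lemma tight_card: "X \<in> tight w y \<Longrightarrow> card X = 2"
  by (simp add: tight_def)

text \<open>Replacing \<open>u\<close> by \<open>t * u i + y i\<close> scales every slack by
  \<open>t > 0\<close>, so subordination and the tight set persist. The inverse change of
  \<open>w\<close> gives the other inclusion in \<open>tight_sets_affine\<close>.\<close>

lemma tight_sets_affine_le: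
  assumes "t > 0" "\<And>X. card X = 2 \<Longrightarrow> w' X = t * w X + sum y X"
  shows "tight_sets w \<subseteq> tight_sets w'"
proof
  fix T assume "T \<in> tight_sets w"
  then obtain u where u: "subordinate w u" "T = tight w u" "T \<noteq> {}"
    by (auto simp: tight_sets_def)
  have sum: "sum (\<lambda>i. t * u i + y i) X = t * sum u X + sum y X" for X
    by (simp add: sum.distrib sum_distrib_left)
  show "T \<in> tight_sets w'"
    using u assms by (intro tight_setsI[of _ "\<lambda>i. t * u i + y i"])
      (auto simp: subordinate_def tight_def sum)
qed

lemma tight_sets_affine:
  assumes "t > 0" "\<And>X. card X = 2 \<Longrightarrow> w' X = t * w X + sum y X"
  shows "tight_sets w' = tight_sets w"
proof
  have "sum (\<lambda>i. - (y i / t)) X = - (sum y X / t)" for X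
    by (simp add: sum_negf sum_divide_distrib)
  then show "tight_sets w' \<subseteq> tight_sets w"
    using assms by (intro tight_sets_affine_le[of "1 / t" _ _ "\<lambda>i. - (y i / t)"])
      (auto simp: field_simps)
qed (rule tight_sets_affine_le[OF assms])

section \<open>The maximal cells induced by the star lift\<close>

definition star_lift :: "'n \<Rightarrow> 'n \<Rightarrow> 'n set \<Rightarrow> real" where
  "star_lift a z X = (if a \<in> X \<and> z \<notin> X then 1 else 0)"

definition pyramid :: "'n \<Rightarrow> 'n \<Rightarrow> 'n set set" where
  "pyramid a z = {X. card X = 2 \<and> (a \<in> X \<longrightarrow> z \<in> X)}"

text \<open>For distinct \<open>a\<close>, \<open>z\<close>, \<open>i\<close> this graph is the
  triangle on them with all further edges hanging from \<open>i\<close>. It is connected, has n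
  edges and contains an odd cycle, so its cell is a full-dimensional simplex.\<close>

definition star_simplex :: "'n \<Rightarrow> 'n \<Rightarrow> 'n \<Rightarrow> 'n set set" where
  "star_simplex a z i = {X. card X = 2 \<and> (i \<in> X \<or> X = {a, z})}"

lemma tight_sets_star_lift:
  assumes "a \<noteq> z"
  shows "pyramid a z \<in> tight_sets (star_lift a z)"
    and "pyramid z a \<in> tight_sets (star_lift a z)"
    and "i \<noteq> a \<Longrightarrow> i \<noteq> z \<Longrightarrow> star_simplex a z i \<in> tight_sets (star_lift a z)"
proof -
  have az: "{a, z} \<in> pyramid a z" "{a, z} \<in> pyramid z a" "{a, z} \<in> star_simplex a z i" for i
    using assms by (auto simp: pyramid_def star_simplex_def)
  have tightI: "T \<in> tight_sets (star_lift a z)"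
    if "{a, z} \<in> T" "\<And>X. X \<in> T \<Longrightarrow> card X = 2"
      "\<And>p q. p \<noteq> q \<Longrightarrow> y p + y q \<le> star_lift a z {p, q}"
      "\<And>p q. p \<noteq> q \<Longrightarrow> {p, q} \<in> T \<longleftrightarrow> y p + y q = star_lift a z {p, q}"
    for T and y :: "'a \<Rightarrow> real"
  proof (rule tight_setsI[of _ y])
    show "tight (star_lift a z) y = T"
      by (intro equalityI pair_set_subsetI) (auto simp: that tight_card pair_in_tight_iff)
  qed (use that in \<open>auto simp: subordinate_iff\<close>)
  show "pyramid a z \<in> tight_sets (star_lift a z)"
    by (rule tightI[of _ "\<lambda>_. 0"]) (use az in \<open>auto simp: pyramid_def star_lift_def\<close>)
  \<comment> \<open>Taking 0 on the elements other than \<open>a\<close> and \<open>z\<close>,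
    tightness of the edges at \<open>a\<close> forces the values 1 at \<open>a\<close> and -1 at
    \<open>z\<close>.\<close>
  show "pyramid z a \<in> tight_sets (star_lift a z)"
    by (rule tightI[of _ "\<lambda>k. if k = a then 1 else if k = z then -1 else 0"])
      (use az assms in \<open>auto simp: pyramid_def star_lift_def\<close>)
  \<comment> \<open>The witness is forced: tight edges at \<open>i\<close> give every element other
    than \<open>a\<close> and \<open>i\<close> the value \<open>- y i\<close>. Then
    \<open>{a, z}\<close> gives \<open>y a = y i\<close>, and \<open>{a, i}\<close> makes both
    1/2.\<close>
  show "star_simplex a z i \<in> tight_sets (star_lift a z)" if "i \<noteq> a" "i \<noteq> z"
    by (rule tightI[of _ "\<lambda>k. if k = a \<or> k = i then 1/2 else -1/2"])
      (use az assms that in \<open>auto simp: star_simplex_def star_lift_def doubleton_eq_iff\<close>)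
qed

text \<open>A tight set inside neither pyramid has an edge from \<open>a\<close> avoiding
  \<open>z\<close> and an edge from \<open>z\<close> avoiding \<open>a\<close>. These must meet in a
  common \<open>i\<close>, and then every edge outside the star of \<open>i\<close>, except
  \<open>{a, z}\<close>, has positive slack.\<close>

lemma tight_sets_star_lift_cover:
  assumes "a \<noteq> z" "T \<in> tight_sets (star_lift a z)"
    and "\<not> T \<subseteq> pyramid a z" "\<not> T \<subseteq> pyramid z a"
  shows "\<exists>i. i \<noteq> a \<and> i \<noteq> z \<and> T \<subseteq> star_simplex a z i"
proof -
  obtain y where y: "subordinate (star_lift a z) y" "T = tight (star_lift a z) y"
    using assms(2) by (auto simp: tight_sets_def)
  have le: "y p + y q \<le> 0" if "p \<noteq> q" "p \<noteq> a" "q \<noteq> a" for p q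
    using y(1) that by (force simp: subordinate_iff star_lift_def)
  have le_az: "y a + y z \<le> 0"
    using y(1) \<open>a \<noteq> z\<close> by (force simp: subordinate_iff star_lift_def)
  have in_T: "{p, q} \<in> T \<longleftrightarrow> p \<noteq> q \<and> y p + y q = star_lift a z {p, q}" for p q
    by (simp add: y(2) pair_in_tight_iff)
  have T_card: "\<And>X. X \<in> T \<Longrightarrow> card X = 2"
    using y(2) tight_card by blast
  have ex_pair: "\<exists>p. p \<noteq> s \<and> p \<noteq> t \<and> {s, p} \<in> T" if not_sub: "\<not> T \<subseteq> pyramid s t" for s t
  proof -
    obtain X where X: "X \<in> T" "X \<notin> pyramid s t"
      using not_sub by auto
    then have "s \<in> X" "t \<notin> X" "card X = 2"
      using T_card by (auto simp: pyramid_def)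
    then obtain p where "X = {s, p}" "s \<noteq> p"
      unfolding card_2_iff by (metis doubleton_eq_iff insertE singletonD)
    with X(1) \<open>t \<notin> X\<close> show ?thesis
      by auto
  qed
  obtain i where i: "i \<noteq> a" "i \<noteq> z" "{a, i} \<in> T"
    using ex_pair[OF assms(3)] by auto
  obtain p where p: "p \<noteq> a" "p \<noteq> z" "{z, p} \<in> T"
    using ex_pair[OF assms(4)] by auto
  have ai: "y a + y i = 1"
    using i \<open>a \<noteq> z\<close> by (simp add: in_T star_lift_def)
  have zp: "y z + y p = 0"
    using p \<open>a \<noteq> z\<close> by (simp add: in_T star_lift_def)
  \<comment> \<open>Adding \<open>ai\<close> and \<open>zp\<close> gives total 1. If
    \<open>p\<close> and \<open>i\<close> differed, regrouping as \<open>y a + y z\<close> plus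
    \<open>y p + y i\<close> would make it at most 0.\<close>
  have "p = i"
    using le[of p i] p i ai zp le_az by fastforce
  with ai zp le_az have yz: "y z = - y i" and yi: "1 \<le> 2 * y i"
    by auto
  \<comment> \<open>Consequently an edge \<open>{a, j}\<close> with \<open>j\<close> other than
    \<open>i\<close> and \<open>z\<close> has sum at most \<open>1 - 2 * y i\<close>, hence at most
    0, below its height 1. An edge avoiding \<open>a\<close> and \<open>i\<close> has sum at most
    \<open>- 2 * y i\<close>, hence at most -1, below its height 0.\<close>
  have yj: "y j \<le> - y i" if "j \<noteq> a" "j \<noteq> i" for j
    using le[of i j] that i by auto
  have "{p, q} \<in> star_simplex a z i" if "p \<noteq> q" "{p, q} \<in> T" for p q
  proof (rule ccontr)
    assume neg: "{p, q} \<notin> star_simplex a z i"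
    have pq: "p \<noteq> i" "q \<noteq> i" "{p, q} \<noteq> {a, z}"
      using neg \<open>p \<noteq> q\<close> by (auto simp: star_simplex_def)
    have eq: "y p + y q = star_lift a z {p, q}"
      using that in_T by blast
    consider "p = a" "q \<noteq> a" "q \<noteq> z" | "q = a" "p \<noteq> a" "p \<noteq> z" | "p \<noteq> a" "q \<noteq> a"
      using \<open>p \<noteq> q\<close> pq(3) by blast
    then show False
      using eq yj[of p] yj[of q] pq ai yi \<open>a \<noteq> z\<close> by cases (auto simp: star_lift_def)
  qed
  then have "T \<subseteq> star_simplex a z i"
    using T_card by (intro pair_set_subsetI)
  with i show ?thesis
    by blast
qed

lemma ex_not_mem:
  assumes "length xs < CARD('n::finite)"
  shows "\<exists>x::'n. x \<notin> set xs"
proof (rule ccontr)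
  assume "\<not> ?thesis"
  then have "set xs = UNIV"
    by auto
  then show False
    using card_length[of xs] assms by simp
qed

text \<open>The count is two pyramids plus one star for each of the n - 2 elements other than
  \<open>a\<close> and \<open>z\<close>.\<close>

lemma spread_star_lift:
  fixes a z :: "'n::finite"
  assumes "a \<noteq> z" "CARD('n) \<ge> 4"
    and w: "tight_sets (w \<circ> char_vec) = tight_sets (star_lift a z)"
  shows "spread (regular_subdivision (hypersimplex 2) w) = CARD('n)"
proof -
  let ?mid = "UNIV - {a, z}"
  let ?M = "{pyramid a z, pyramid z a} \<union> star_simplex a z ` ?mid"
  \<comment> \<open>This is where n >= 4 enters: for such \<open>j\<close> the edges
    \<open>{z, j}\<close> and \<open>{a, j}\<close> show that neither pyramid lies in the star of
    \<open>i\<close>.\<close>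
  have other: "\<exists>j. j \<noteq> a \<and> j \<noteq> z \<and> j \<noteq> i" for i
    using ex_not_mem[of "[a, z, i]"] assms(2) by auto
  have ends: "\<not> pyramid a z \<subseteq> pyramid z a" "\<not> pyramid z a \<subseteq> pyramid a z"
  proof -
    obtain j where "j \<noteq> a" "j \<noteq> z"
      using other by blast
    then have "{z, j} \<in> pyramid a z - pyramid z a" "{a, j} \<in> pyramid z a - pyramid a z"
      using \<open>a \<noteq> z\<close> by (auto simp: pyramid_def)
    then show "\<not> pyramid a z \<subseteq> pyramid z a" "\<not> pyramid z a \<subseteq> pyramid a z"
      by blast+
  qed
  have not_in_star: "\<not> pyramid a z \<subseteq> star_simplex a z i" "\<not> pyramid z a \<subseteq> star_simplex a z i" if "i \<in> ?mid" for i
  proof -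
    obtain j where "j \<noteq> a" "j \<noteq> z" "j \<noteq> i"
      using other by blast
    then have "{z, j} \<in> pyramid a z - star_simplex a z i" "{a, j} \<in> pyramid z a - star_simplex a z i"
      using \<open>a \<noteq> z\<close> that by (auto simp: pyramid_def star_simplex_def doubleton_eq_iff)
    then show "\<not> pyramid a z \<subseteq> star_simplex a z i" "\<not> pyramid z a \<subseteq> star_simplex a z i"
      by blast+
  qed
  have star_not_in: "\<not> star_simplex a z i \<subseteq> pyramid a z" "\<not> star_simplex a z i \<subseteq> pyramid z a"
    "star_simplex a z i \<subseteq> star_simplex a z j \<Longrightarrow> i = j" if "i \<in> ?mid" "j \<in> ?mid" for i j
  proof -
    have "{a, i} \<in> star_simplex a z i - pyramid a z" "{z, i} \<in> star_simplex a z i - pyramid z a"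
      "{a, i} \<in> star_simplex a z i" "i \<noteq> j \<Longrightarrow> {a, i} \<notin> star_simplex a z j"
      using \<open>a \<noteq> z\<close> that by (auto simp: pyramid_def star_simplex_def doubleton_eq_iff)
    then show "\<not> star_simplex a z i \<subseteq> pyramid a z" "\<not> star_simplex a z i \<subseteq> pyramid z a"
      "star_simplex a z i \<subseteq> star_simplex a z j \<Longrightarrow> i = j"
      by blast+
  qed
  have "spread (regular_subdivision (hypersimplex 2) w) = card ?M"
  proof (rule spread_eq_card)
    show "?M \<subseteq> tight_sets (w \<circ> char_vec)"
      using tight_sets_star_lift[OF \<open>a \<noteq> z\<close>] by (auto simp: w)
    show "\<exists>U\<in>?M. T \<subseteq> U" if "T \<in> tight_sets (w \<circ> char_vec)" for T
      using tight_sets_star_lift_cover[OF \<open>a \<noteq> z\<close>, of T] that by (auto simp: w)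
    show "T = U" if TU: "T \<in> ?M" "U \<in> ?M" "T \<subseteq> U" for T U
    proof -
      consider "T \<in> {pyramid a z, pyramid z a}" "U \<in> {pyramid a z, pyramid z a}"
        | i where "T \<in> {pyramid a z, pyramid z a}" "i \<in> ?mid" "U = star_simplex a z i"
        | i where "i \<in> ?mid" "T = star_simplex a z i" "U \<in> {pyramid a z, pyramid z a}"
        | i j where "i \<in> ?mid" "j \<in> ?mid" "T = star_simplex a z i" "U = star_simplex a z j"
        using TU(1,2) unfolding Un_iff image_iff by metis
      then show ?thesis
      proof cases
        case 1
        with \<open>T \<subseteq> U\<close> ends show ?thesis by auto
      next
        case (2 i)
        with \<open>T \<subseteq> U\<close> not_in_star[of i] show ?thesis by auto
      next
        case (3 i)
        with \<open>T \<subseteq> U\<close> star_not_in[of i i] show ?thesis by auto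
      next
        case (4 i j)
        with \<open>T \<subseteq> U\<close> star_not_in(3)[of i j] show ?thesis by auto
      qed
    qed
  qed
  also have "card ?M = 2 + card (star_simplex a z ` ?mid)"
  proof (subst card_Un_disjoint)
    show "{pyramid a z, pyramid z a} \<inter> star_simplex a z ` ?mid = {}"
      using not_in_star by blast
    show "card {pyramid a z, pyramid z a} + card (star_simplex a z ` ?mid) =
        2 + card (star_simplex a z ` ?mid)"
      using ends by (auto simp: card_insert_if)
  qed auto
  also have "card (star_simplex a z ` ?mid) = card ?mid"
    using star_not_in(3) by (intro card_image inj_onI) blast
  also have "2 + card ?mid = CARD('n)"
    using assms by (simp add: card_Diff_subset)
  finally show ?thesis .
qed

section \<open>A cell that is not a matroid polytope\<close>

lemma non_matroidal_pyramid:
  fixes a z :: "'n::finite"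
  assumes "a \<noteq> z" "CARD('n) \<ge> 4"
  shows "\<not> matroid_polytope (cell (pyramid a z))"
proof
  obtain b where b: "b \<noteq> a" "b \<noteq> z"
    using ex_not_mem[of "[a, z]"] assms by auto
  obtain c where c: "c \<noteq> a" "c \<noteq> z" "c \<noteq> b"
    using ex_not_mem[of "[a, z, b]"] assms by auto
  \<comment> \<open>The weights single out the edge from apex to base: in the pyramid
    \<open>a\<close> occurs only with \<open>z\<close>, giving 1 + 0, and among the edges avoiding
    \<open>a\<close> only \<open>{b, c}\<close> reaches 1/2 + 1/2.\<close>
  define f :: "real ^ 'n" where "f = (\<chi> k. if k = a then 1 else if k = b \<or> k = c then 1/2 else 0)"
  have pair: "f \<bullet> char_vec {p, q} = f $ p + f $ q" if "p \<noteq> q" for p q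
    using that by (simp add: inner_char_vec)
  have le: "f \<bullet> char_vec X \<le> 1" and eq: "f \<bullet> char_vec X = 1 \<Longrightarrow> X = {a, z} \<or> X = {b, c}"
    if "X \<in> pyramid a z" for X
  proof -
    obtain p q where X: "X = {p, q}" "p \<noteq> q"
      using \<open>X \<in> pyramid a z\<close> by (auto simp: pyramid_def card_2_iff)
    have le_half: "f $ k \<le> 1/2" and eq_half: "f $ k = 1/2 \<longleftrightarrow> k = b \<or> k = c" if "k \<noteq> a" for k
      using that by (simp_all add: f_def)
    have "f \<bullet> char_vec X \<le> 1 \<and> (f \<bullet> char_vec X = 1 \<longrightarrow> X = {a, z} \<or> X = {b, c})"
    proof (cases "a \<in> X")
      case True
      then have "X = {a, z}"
        using \<open>X \<in> pyramid a z\<close> X assms(1) by (auto simp: pyramid_def)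
      then show ?thesis
        using pair[OF assms(1)] assms(1) b c by (simp add: f_def)
    next
      case False
      then have "p \<noteq> a" "q \<noteq> a"
        using X by auto
      then show ?thesis
        using X le_half[of p] le_half[of q] eq_half[of p] eq_half[of q] pair[of p q] by auto
    qed
    then show "f \<bullet> char_vec X \<le> 1" "f \<bullet> char_vec X = 1 \<Longrightarrow> X = {a, z} \<or> X = {b, c}"
      by auto
  qed
  have mem: "{a, z} \<in> pyramid a z" "{b, c} \<in> pyramid a z"
    "f \<bullet> char_vec {a, z} = 1" "f \<bullet> char_vec {b, c} = 1"
    using pair[of a z] pair[of b c] assms(1) b c by (auto simp: f_def pyramid_def)
  define E where "E = cell (pyramid a z) \<inter> {x. f \<bullet> x = 1}"
  have "{x \<in> char_vec ` pyramid a z. f \<bullet> x = 1} = {char_vec {a, z}, char_vec {b, c}}"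
    using eq mem by auto
  moreover have "E = convex hull {x \<in> char_vec ` pyramid a z. f \<bullet> x = 1}"
    unfolding E_def cell_def by (rule convex_hull_Int_supporting_hyperplane) (use le in auto)
  ultimately have E: "E = convex hull {char_vec {a, z}, char_vec {b, c}}"
    by simp
  have "E face_of cell (pyramid a z)"
    unfolding E_def cell_def by (rule convex_hull_Int_supporting_hyperplane) (use le in auto)
  moreover have "aff_dim E = 1"
    using assms(1) b c by (simp add: E aff_dim_convex_hull doubleton_eq_iff)
  ultimately have "E edge_of cell (pyramid a z)"
    by (simp add: edge_of_def)
  moreover assume "matroid_polytope (cell (pyramid a z))"
  ultimately obtain i j where "i \<noteq> j"
    and ij: "\<forall>x\<in>E. \<forall>y\<in>E. \<exists>c. x - y = c *\<^sub>R (axis i 1 - axis j 1)"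
    unfolding matroid_polytope_def by blast
  have "char_vec {a, z} \<in> E" "char_vec {b, c} \<in> E"
    by (simp_all add: E hull_inc)
  with ij obtain t where t: "char_vec {a, z} - char_vec {b, c} = t *\<^sub>R (axis i 1 - axis j 1)"
    by meson
  have "(if k \<in> {a, z} then 1 else 0) - (if k \<in> {b, c} then 1 else 0) =
      t * ((if k = i then 1 else 0) - (if k = j then 1 else 0))" for k
    using arg_cong[OF t, of "\<lambda>x. x $ k"] by (simp add: char_vec_nth axis_def)
  \<comment> \<open>The left side is nonzero at the three coordinates \<open>a\<close>,
    \<open>z\<close>, \<open>b\<close>, while the right side is supported on
    \<open>{i, j}\<close>.\<close>
  from this[of a] this[of z] this[of b] show False
    using assms(1) b c \<open>i \<noteq> j\<close> by (auto split: if_splits)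
qed


section \<open>The secondary cone and the lineality space\<close>

lemma linear_if_pyramids_tight:
  fixes a z :: "'n::finite"
  assumes "a \<noteq> z" "CARD('n) \<ge> 5"
    and "pyramid a z \<in> tight_sets w" "pyramid z a \<in> tight_sets w"
  shows "\<exists>t\<ge>0. \<exists>y. \<forall>X. card X = 2 \<longrightarrow> w X = t * star_lift a z X + sum y X"
proof -
  obtain y where y: "subordinate w y" "pyramid a z = tight w y"
    using assms(3) by (auto simp: tight_sets_def)
  obtain u where u: "pyramid z a = tight w u"
    using assms(4) by (auto simp: tight_sets_def)
  have y_eq: "w {p, q} = y p + y q" if "p \<noteq> q" "a \<in> {p, q} \<Longrightarrow> z \<in> {p, q}" for p q
  proof -
    have "{p, q} \<in> pyramid a z"
      using that by (auto simp: pyramid_def)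
    then show ?thesis
      by (simp add: y(2) pair_in_tight_iff)
  qed
  have u_eq: "w {p, q} = u p + u q" if "p \<noteq> q" "z \<in> {p, q} \<Longrightarrow> a \<in> {p, q}" for p q
  proof -
    have "{p, q} \<in> pyramid z a"
      using that by (auto simp: pyramid_def)
    then show ?thesis
      by (simp add: u pair_in_tight_iff)
  qed
  \<comment> \<open>On the edges avoiding \<open>a\<close> and \<open>z\<close> both
    \<open>y\<close> and \<open>u\<close> compute \<open>w\<close>. A triangle of such edges
    determines the three values, which needs n >= 5.\<close>
  have mid: "u j = y j" if "j \<noteq> a" "j \<noteq> z" for j
  proof -
    obtain k where k: "k \<noteq> a" "k \<noteq> z" "k \<noteq> j"
      using ex_not_mem[of "[a, z, j]"] assms(2) by auto
    obtain l where l: "l \<noteq> a" "l \<noteq> z" "l \<noteq> j" "l \<noteq> k"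
      using ex_not_mem[of "[a, z, j, k]"] assms(2) by auto
    have "y p + y q = u p + u q" if "p \<noteq> q" "p \<notin> {a, z}" "q \<notin> {a, z}" for p q
      using y_eq[of p q] u_eq[of p q] that by auto
    from this[of j k] this[of j l] this[of k l] show ?thesis
      using that k l by auto
  qed
  obtain b where b: "b \<noteq> a" "b \<noteq> z"
    using ex_not_mem[of "[a, z]"] assms(2) by auto
  \<comment> \<open>The coefficient will be \<open>u a - y a\<close>; its sign comes from
    \<open>y\<close> being subordinate on an edge outside \<open>pyramid a z\<close>.\<close>
  have "y a + y b \<le> w {a, b}"
    using y(1) b by (simp add: subordinate_iff)
  also have "w {a, b} = u a + u b"
    using b \<open>a \<noteq> z\<close> by (intro u_eq) auto
  finally have "0 \<le> u a - y a"
    using mid[OF b] by simp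
  moreover have "w X = (u a - y a) * star_lift a z X + sum y X" if X: "card X = 2" for X
  proof (cases "a \<in> X \<and> z \<notin> X")
    case True
    then obtain j where j: "X = {a, j}" "j \<noteq> a" "j \<noteq> z"
      using X unfolding card_2_iff by (metis insert_commute insertE insertI1 singletonD)
    then have "w X = u a + u j"
      using \<open>a \<noteq> z\<close> by (auto intro: u_eq)
    then show ?thesis
      using j mid[of j] \<open>a \<noteq> z\<close> by (simp add: star_lift_def)
  next
    case False
    obtain p q where "X = {p, q}" "p \<noteq> q"
      using X by (auto simp: card_2_iff)
    then show ?thesis
      using False y_eq[of p q] by (auto simp: star_lift_def)
  qed
  ultimately show ?thesis
    by blast
qed

text \<open>
  A linear function on the vertices is recovered from its values on the triangle \<open>{b, c, z}\<close>
  and on the edges at \<open>z\<close>. The edges of this graph lie in \<open>pyramid a z\<close>, where \<open>star_lift a z\<close>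
  vanishes.
\<close>

definition coord :: "'n \<Rightarrow> 'n \<Rightarrow> 'n \<Rightarrow> ('n set \<Rightarrow> real) \<Rightarrow> 'n \<Rightarrow> real" where
  "coord b c z w i =
     (let y = (w {b, z} + w {c, z} - w {b, c}) / 2 in if i = z then y else w {i, z} - y)"

text \<open>For \<open>b\<close> other than \<open>a\<close> and \<open>z\<close>,
  \<open>star_lift a z\<close> is 1 on \<open>{a, b}\<close>, so the excess over the linear part
  there is its coefficient.\<close>

definition height :: "'n \<Rightarrow> 'n \<Rightarrow> 'n \<Rightarrow> 'n \<Rightarrow> ('n set \<Rightarrow> real) \<Rightarrow> real" where
  "height a b c z w = w {a, b} - coord b c z w a - coord b c z w b"

lemma coord_height_eq:
  assumes w: "\<And>X. card X = 2 \<Longrightarrow> w X = t * star_lift a z X + sum y X"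
    and "a \<noteq> z" "b \<noteq> a" "b \<noteq> z" "c \<noteq> a" "c \<noteq> z" "b \<noteq> c"
  shows "coord b c z w = y" and "height a b c z w = t"
proof -
  have pair: "w {p, q} = t * star_lift a z {p, q} + (y p + y q)" if "p \<noteq> q" for p q
    using w[of "{p, q}"] that by simp
  show coord: "coord b c z w = y"
    using assms by (auto simp: coord_def Let_def pair star_lift_def field_simps)
  show "height a b c z w = t"
    unfolding height_def coord using assms by (auto simp: pair star_lift_def)
qed

text \<open>The unknown \<open>t\<close> and \<open>y\<close> are replaced by explicit continuous
  expressions in \<open>w\<close>, which makes closedness visible.\<close>

lemma star_linear_iff:
  assumes "a \<noteq> z" "b \<noteq> a" "b \<noteq> z" "c \<noteq> a" "c \<noteq> z" "b \<noteq> c"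
  shows "(\<exists>t y. t \<in> A \<and> (\<forall>X. card X = 2 \<longrightarrow> w X = t * star_lift a z X + sum y X)) \<longleftrightarrow>
    height a b c z w \<in> A \<and> (\<forall>X. card X = 2 \<longrightarrow>
      w X = height a b c z w * star_lift a z X + sum (coord b c z w) X)"
proof
  assume "\<exists>t y. t \<in> A \<and> (\<forall>X. card X = 2 \<longrightarrow> w X = t * star_lift a z X + sum y X)"
  then obtain t y where t: "t \<in> A" "\<And>X. card X = 2 \<Longrightarrow> w X = t * star_lift a z X + sum y X"
    by blast
  show "height a b c z w \<in> A \<and> (\<forall>X. card X = 2 \<longrightarrow>
      w X = height a b c z w * star_lift a z X + sum (coord b c z w) X)"
    using t coord_height_eq[OF t(2) assms] by simp
qed blast

text \<open>The set \<open>A\<close> serves two uses: \<open>{0}\<close> yields the lineality space,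
  \<open>{0..}\<close> bounds the secondary cone of the star subdivision.\<close>

definition star_linear :: "real set \<Rightarrow> 'n \<Rightarrow> 'n \<Rightarrow> (real ^ 'n \<Rightarrow> real) set" where
  "star_linear A a z = {w \<in> lifting_functions (hypersimplex 2).
     \<exists>t y. t \<in> A \<and> (\<forall>X. card X = 2 \<longrightarrow> w (char_vec X) = t * star_lift a z X + sum y X)}"

lemma closed_star_linear:
  fixes a z :: "'n::finite"
  assumes "a \<noteq> z" "CARD('n) \<ge> 4" "closed A"
  shows "closed (star_linear A a z)"
proof -
  obtain b where b: "b \<noteq> a" "b \<noteq> z"
    using ex_not_mem[of "[a, z]"] assms by auto
  obtain c where c: "c \<noteq> a" "c \<noteq> z" "b \<noteq> c"
    using ex_not_mem[of "[a, z, b]"] assms by auto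
  let ?w = "\<lambda>(w :: real ^ 'n \<Rightarrow> real) X. w (char_vec X)"
  have coord: "continuous_on UNIV (\<lambda>w. coord b c z (?w w) i)" for i
    by (cases "i = z") (auto simp: coord_def Let_def intro!: continuous_intros)
  have height: "continuous_on UNIV (\<lambda>w. height a b c z (?w w))"
    unfolding height_def by (auto intro!: continuous_intros coord)
  have "star_linear A a z = {w. (\<forall>x. x \<notin> vertices (hypersimplex 2) \<longrightarrow> w x = 0) \<and>
      height a b c z (?w w) \<in> A \<and> (\<forall>X. card X = 2 \<longrightarrow>
      w (char_vec X) = height a b c z (?w w) * star_lift a z X + (\<Sum>i\<in>X. coord b c z (?w w) i))}"
    using star_linear_iff[OF assms(1) b c, of A]
    by (auto simp: star_linear_def lifting_functions_def)
  also have "closed \<dots>"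
    by (intro closed_Collect_conj closed_Collect_all closed_Collect_imp closed_Collect_eq
        open_Collect_const closed_vimage[OF assms(3) height, unfolded vimage_def]
        continuous_intros height coord continuous_on_product_coordinates)
  finally show ?thesis .
qed

lemma regular_subdivision_affine:
  fixes w w' :: "real ^ 'n \<Rightarrow> real"
  assumes "t > 0" "\<And>X. card X = 2 \<Longrightarrow> w' (char_vec X) = t * w (char_vec X) + sum y X"
  shows "regular_subdivision (hypersimplex 2) w' = regular_subdivision (hypersimplex 2) w"
  unfolding regular_subdivision_hypersimplex_eq_iff
  by (rule tight_sets_affine[of t _ _ y]) (use assms in auto)

text \<open>The ray for \<open>t > 0\<close> consists of functions inducing \<open>S\<close>; the
  closure adds its endpoint \<open>l\<close>.\<close>

lemma secondary_cone_limit: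
  assumes "l \<in> lifting_functions P" "r \<in> lifting_functions P" "t0 \<ge> 0"
    and "\<And>t. t > 0 \<Longrightarrow> regular_subdivision P (\<lambda>x. t * r x + l x) = S"
  shows "(\<lambda>x. t0 * r x + l x) \<in> secondary_cone P S"
proof -
  let ?g = "\<lambda>t x. t * r x + l x"
  have "?g ` closure {0<..} \<subseteq> secondary_cone P S"
  proof (rule image_closure_subset)
    show "continuous_on (closure {0<..}) ?g"
      by (intro continuous_on_coordinatewise_then_product continuous_intros)
    show "closed (secondary_cone P S)"
      by (simp add: secondary_cone_def)
    have "?g t \<in> {w \<in> lifting_functions P. regular_subdivision P w = S}" if "t > 0" for t
      using assms that by (auto simp: lifting_functions_def)
    then show "?g ` {0<..} \<subseteq> secondary_cone P S"
      unfolding secondary_cone_def using closure_subset by blast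
  qed
  then show ?thesis
    using assms(3) by auto
qed

lemma secondary_cone_star_linear:
  assumes "a \<noteq> z" "CARD('n) \<ge> 4" "closed A"
    and "\<And>w. regular_subdivision (hypersimplex 2) w = S \<Longrightarrow>
      \<exists>t y. t \<in> A \<and> (\<forall>X. card X = 2 \<longrightarrow> w (char_vec X) = t * star_lift a z X + sum y X)"
  shows "secondary_cone (hypersimplex 2 :: (real ^ 'n::finite) set) S \<subseteq> star_linear A a z"
  unfolding secondary_cone_def
  by (rule closure_minimal) (use assms closed_star_linear in \<open>auto simp: star_linear_def\<close>)

text \<open>The cone of the trivial subdivision contains only linear functions. Conversely, adding a
  linear function changes no subdivision, so both signs of it are limits in every cone.\<close>

lemma secondary_lineality_hypersimplex:
  fixes a z :: "'n::finite"
  assumes "a \<noteq> z" "CARD('n) \<ge> 4"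
  shows "secondary_lineality (hypersimplex 2) = star_linear {0} a z"
proof (intro equalityI subsetI)
  fix l :: "real ^ 'n \<Rightarrow> real"
  assume "l \<in> secondary_lineality (hypersimplex 2)"
  then have "l \<in> secondary_cone (hypersimplex 2) (regular_subdivision (hypersimplex 2) (\<lambda>_. 0))"
    unfolding secondary_lineality_def by blast
  moreover have "\<exists>t y. t \<in> {0} \<and> (\<forall>X. card X = 2 \<longrightarrow> w (char_vec X) = t * star_lift a z X + sum y X)"
    if "regular_subdivision (hypersimplex 2) w = regular_subdivision (hypersimplex 2) (\<lambda>_. 0)"
    for w :: "real ^ 'n \<Rightarrow> real"
  proof -
    \<comment> \<open>The whole hypersimplex is a cell for the zero lift, hence for
      \<open>w\<close>; a function tight on all edges makes \<open>w\<close> linear.\<close>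
    have "{a, z} \<in> {X. card X = 2}"
      using assms(1) by simp
    then have "{X. card X = 2} \<noteq> ({} :: 'n set set)"
      by blast
    then have "{X. card X = 2} \<in> tight_sets ((\<lambda>_. 0) \<circ> (char_vec :: 'n set \<Rightarrow> _))"
      by (intro tight_setsI[of _ "\<lambda>_. 0"]) (auto simp: subordinate_def tight_def)
    then have "{X. card X = 2} \<in> tight_sets (w \<circ> char_vec)"
      using that by (simp add: regular_subdivision_hypersimplex_eq_iff)
    then obtain y where "{X. card X = 2} = tight (w \<circ> char_vec) y"
      by (auto simp: tight_sets_def)
    then have "\<forall>X. card X = 2 \<longrightarrow> w (char_vec X) = 0 * star_lift a z X + sum y X"
      by (simp add: tight_def set_eq_iff) metis
    then show ?thesis
      by blast
  qed
  ultimately show "l \<in> star_linear {0} a z"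
    using secondary_cone_star_linear[OF assms, of "{0}"] by blast
next
  fix l :: "real ^ 'n \<Rightarrow> real"
  assume "l \<in> star_linear {0} a z"
  then obtain y where l: "l \<in> lifting_functions (hypersimplex 2)"
    "\<And>X. card X = 2 \<Longrightarrow> l (char_vec X) = sum y X"
    by (auto simp: star_linear_def)
  have "(\<lambda>x. s * l x) \<in> secondary_cone (hypersimplex 2) (regular_subdivision (hypersimplex 2) w)"
    for w :: "real ^ 'n \<Rightarrow> real" and s
  proof -
    \<comment> \<open>Lifting functions vanish off the vertices, so \<open>w\<close> is truncated;
      the subdivision sees only the vertex values.\<close>
    let ?r = "\<lambda>x. if x \<in> vertices (hypersimplex 2) then w x else 0"
    have "(\<lambda>x. 0 * ?r x + s * l x) \<in>
        secondary_cone (hypersimplex 2) (regular_subdivision (hypersimplex 2) w)"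
    proof (rule secondary_cone_limit)
      show "regular_subdivision (hypersimplex 2) (\<lambda>x. t * ?r x + s * l x) =
          regular_subdivision (hypersimplex 2) w" if "t > 0" for t
        by (rule regular_subdivision_affine[of t _ _ "\<lambda>i. s * y i"])
          (use that l(2) in \<open>auto simp: vertices_hypersimplex sum_distrib_left\<close>)
    qed (use l(1) in \<open>auto simp: lifting_functions_def\<close>)
    then show ?thesis
      by simp
  qed
  from this[of 1] this[of "-1"] show "l \<in> secondary_lineality (hypersimplex 2)"
    by (simp add: secondary_lineality_def)
qed

lemma coarsest_star_lift:
  fixes a z :: "'n::finite"
  assumes "a \<noteq> z" "CARD('n) \<ge> 5"
    and w: "\<And>X. card X = 2 \<Longrightarrow> w (char_vec X) = star_lift a z X"
  shows "coarsest_subdivision (hypersimplex 2) (regular_subdivision (hypersimplex 2) w)"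
proof -
  let ?P = "hypersimplex 2 :: (real ^ 'n) set"
  let ?S = "regular_subdivision ?P w"
  have card4: "CARD('n) \<ge> 4"
    using assms(2) by simp
  note lin = secondary_lineality_hypersimplex[OF assms(1) card4]
  define r where "r x = (if x \<in> vertices ?P then w x else 0)" for x
  have r: "r (char_vec X) = star_lift a z X" if "card X = 2" for X
    using that by (simp add: r_def w vertices_hypersimplex)
  have r_lift: "r \<in> lifting_functions ?P"
    by (simp add: lifting_functions_def r_def)
  have "r \<notin> star_linear {0} a z"
  proof
    assume "r \<in> star_linear {0} a z"
    then obtain y where "\<And>X. card X = 2 \<Longrightarrow> r (char_vec X) = 0 * star_lift a z X + sum y X"
      by (auto simp: star_linear_def)
    then have y: "star_lift a z X = 0 * star_lift a z X + sum y X" if "card X = 2" for X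
      using r that by metis
    obtain b where b: "b \<noteq> a" "b \<noteq> z"
      using ex_not_mem[of "[a, z]"] card4 by auto
    obtain c where c: "c \<noteq> a" "c \<noteq> z" "b \<noteq> c"
      using ex_not_mem[of "[a, z, b]"] card4 by auto
    have "star_lift a z X = 1 * star_lift a z X + sum (\<lambda>_. 0) X" for X
      by simp
    \<comment> \<open>If \<open>star_lift a z\<close> were linear, its height would be both 0 and
      1.\<close>
    with coord_height_eq(2)[OF y assms(1) b c]
      coord_height_eq(2)[of "star_lift a z" 1 a z "\<lambda>_. 0", OF _ assms(1) b c]
    show False
      by simp
  qed
  moreover have "secondary_cone ?P ?S = {\<lambda>x. t * r x + l x | t l. 0 \<le> t \<and> l \<in> star_linear {0} a z}"
  proof (intro equalityI subsetI)
    fix f assume f: "f \<in> secondary_cone ?P ?S"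
    \<comment> \<open>Every lift inducing the subdivision has both pyramids tight, so it is a
      nonnegative multiple of the star lift up to a linear function; closedness extends this to the
      limits.\<close>
    have "secondary_cone ?P ?S \<subseteq> star_linear {0..} a z"
    proof (rule secondary_cone_star_linear[OF assms(1) card4])
      fix u :: "real ^ 'n \<Rightarrow> real"
      assume "regular_subdivision ?P u = ?S"
      then have "tight_sets (u \<circ> char_vec) = tight_sets (star_lift a z)"
        unfolding regular_subdivision_hypersimplex_eq_iff
        using tight_sets_affine[of 1 "w \<circ> char_vec" "star_lift a z" "\<lambda>_. 0"] by (simp add: w)
      then have "pyramid a z \<in> tight_sets (u \<circ> char_vec)" "pyramid z a \<in> tight_sets (u \<circ> char_vec)"
        using tight_sets_star_lift[OF assms(1)] by auto
      from linear_if_pyramids_tight[OF assms(1,2) this]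
      show "\<exists>t y. t \<in> {0..} \<and>
          (\<forall>X. card X = 2 \<longrightarrow> u (char_vec X) = t * star_lift a z X + sum y X)"
        by auto
    qed simp
    with f obtain t y where f: "f \<in> lifting_functions ?P" "t \<ge> 0"
      "\<And>X. card X = 2 \<Longrightarrow> f (char_vec X) = t * star_lift a z X + sum y X"
      by (auto simp: star_linear_def)
    have "(\<lambda>x. f x - t * r x) \<in> star_linear {0} a z"
      unfolding star_linear_def using f r r_lift by (auto simp: lifting_functions_def)
    then show "f \<in> {\<lambda>x. t * r x + l x | t l. 0 \<le> t \<and> l \<in> star_linear {0} a z}"
      using f(2) by (intro CollectI exI[of _ t] exI[of _ "\<lambda>x. f x - t * r x"]) auto
  next
    fix f assume "f \<in> {\<lambda>x. t * r x + l x | t l. 0 \<le> t \<and> l \<in> star_linear {0} a z}"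
    then obtain t l y where f: "f = (\<lambda>x. t * r x + l x)" "t \<ge> 0" "l \<in> lifting_functions ?P"
      "\<And>X. card X = 2 \<Longrightarrow> l (char_vec X) = sum y X"
      by (auto simp: star_linear_def)
    show "f \<in> secondary_cone ?P ?S"
      unfolding f(1)
    proof (rule secondary_cone_limit[OF f(3) r_lift f(2)])
      show "regular_subdivision ?P (\<lambda>x. t * r x + l x) = ?S" if "t > 0" for t
        by (rule regular_subdivision_affine[of t _ _ y]) (use that f(4) r w in auto)
    qed
  qed
  ultimately show ?thesis
    unfolding coarsest_subdivision_def lin using r_lift by blast
qed

section \<open>Identifying the given lift through the lexicographic order\<close>

lemma lex_less_char_vec:
  "lex_less (char_vec X) (char_vec Y) \<longleftrightarrow> (\<exists>i. i \<notin> X \<and> i \<in> Y \<and> (\<forall>j<i. j \<in> X \<longleftrightarrow> j \<in> Y))"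
  by (auto simp: lex_less_def char_vec_nth split: if_splits)

lemma lex_less_irrefl: "\<not> lex_less x x"
  by (simp add: lex_less_def)

lemma lex_less_asym: "lex_less x y \<Longrightarrow> \<not> lex_less y x"
  unfolding lex_less_def by (metis less_asym linorder_neqE)

text \<open>At the first difference \<open>X\<close> contains some \<open>i\<close> other than
  \<open>a\<close> and \<open>z\<close>. Agreement before \<open>i\<close> puts \<open>a\<close>
  into \<open>X\<close>, which is then full and misses \<open>z\<close>.\<close>

lemma lex_greater_first_last:
  fixes a z :: "'n::{finite,linorder}"
  assumes a: "\<And>i. a \<le> i" and z: "\<And>i. i \<le> z" and X: "card X = 2"
  shows "lex_less (char_vec {a, z}) (char_vec X) \<longleftrightarrow> a \<in> X \<and> z \<notin> X"
proof
  assume "lex_less (char_vec {a, z}) (char_vec X)"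
  then obtain i where i: "i \<noteq> a" "i \<noteq> z" "i \<in> X" "\<And>j. j < i \<Longrightarrow> j \<in> {a, z} \<longleftrightarrow> j \<in> X"
    by (auto simp: lex_less_char_vec)
  have "a \<in> X"
    using i(1) i(4)[of a] a[of i] by auto
  moreover have "a \<noteq> z"
    using a z i(1) by (metis order_antisym)
  ultimately show "a \<in> X \<and> z \<notin> X"
    using X i by (auto simp: card_2_iff)
next
  assume "a \<in> X \<and> z \<notin> X"
  then obtain i where i: "X = {a, i}" "i \<noteq> a" "i \<noteq> z"
    using X unfolding card_2_iff by (metis insert_commute insertE insertI1 singletonD)
  have "\<not> z < i"
    using z by (simp add: leD)
  then show "lex_less (char_vec {a, z}) (char_vec X)"
    unfolding lex_less_char_vec using i by (intro exI[of _ i]) auto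
qed

lemma lift_eq_star_lift:
  fixes v :: "nat \<Rightarrow> real ^ ('n::{finite,linorder})" and a z :: 'n
  assumes a: "\<And>i. a \<le> i" and z: "\<And>i. i \<le> z" and "a \<noteq> z"
    and v_enum: "bij_betw v {1..N} (vertices (hypersimplex 2))"
    and v_desc: "\<And>i j. 1 \<le> i \<Longrightarrow> i < j \<Longrightarrow> j \<le> N \<Longrightarrow> lex_less (v j) (v i)"
    and lam: "\<And>i. 1 \<le> i \<Longrightarrow> i \<le> N \<Longrightarrow> lam (v i) = (if i \<le> CARD('n) - 2 then 1 else 0)"
    and X: "card X = 2"
  shows "lam (char_vec X) = star_lift a z X"
proof -
  have ex: "\<exists>i\<in>{1..N}. v i = char_vec Y" if "card Y = 2" for Y
  proof -
    have "char_vec Y \<in> v ` {1..N}"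
      using v_enum that by (simp add: bij_betw_def vertices_hypersimplex)
    then show ?thesis
      by (metis imageE)
  qed
  have lex_iff: "lex_less (v j) (v i) \<longleftrightarrow> i < j" if "i \<in> {1..N}" "j \<in> {1..N}" for i j
    using that v_desc lex_less_asym lex_less_irrefl by (metis atLeastAtMost_iff linorder_neqE_nat)
  \<comment> \<open>The vertices listed before \<open>{a, z}\<close> are the \<open>{a, i}\<close>
    with \<open>i\<close> other than \<open>z\<close>, so \<open>m - 1 = n - 2\<close> and the lift
    is 1 exactly before position \<open>m\<close>.\<close>
  obtain m where m: "m \<in> {1..N}" "v m = char_vec {a, z}"
    using ex[of "{a, z}"] \<open>a \<noteq> z\<close> by auto
  have "{1..<m} = {i \<in> {1..N}. lex_less (v m) (v i)}"
    using m(1) lex_iff by auto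
  then have "v ` {1..<m} = {x \<in> v ` {1..N}. lex_less (v m) x}"
    by auto
  also have "v ` {1..N} = char_vec ` {Y. card Y = 2}"
    using v_enum by (simp add: bij_betw_def vertices_hypersimplex)
  also have "{x \<in> \<dots>. lex_less (v m) x} = char_vec ` {Y. card Y = 2 \<and> a \<in> Y \<and> z \<notin> Y}"
    using lex_greater_first_last[OF a z] m by auto
  also have "{Y. card Y = 2 \<and> a \<in> Y \<and> z \<notin> Y} = (\<lambda>i. {a, i}) ` (UNIV - {a, z})"
    using \<open>a \<noteq> z\<close> by (auto simp: card_2_iff)
  finally have "card (v ` {1..<m}) = card (char_vec ` (\<lambda>i. {a, i}) ` (UNIV - {a, z}))"
    by simp
  also have "\<dots> = CARD('n) - 2"
    using \<open>a \<noteq> z\<close>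
    by (simp add: image_image card_image inj_on_def doubleton_eq_iff card_Diff_subset)
  also have "card (v ` {1..<m}) = m - 1"
    using v_enum m by (subst card_image) (auto simp: bij_betw_def intro: inj_on_subset)
  finally have m_eq: "m - 1 = CARD('n) - 2" .
  obtain i where i: "i \<in> {1..N}" "v i = char_vec X"
    using ex[OF X] by auto
  have "i \<le> CARD('n) - 2 \<longleftrightarrow> i < m"
    using m_eq m(1) by auto
  also have "\<dots> \<longleftrightarrow> lex_less (v m) (v i)"
    using lex_iff i(1) m(1) by simp
  also have "\<dots> \<longleftrightarrow> a \<in> X \<and> z \<notin> X"
    using lex_greater_first_last[OF a z X] i m by simp
  finally show ?thesis
    using lam[of i] i by (simp add: star_lift_def)
qed

text \<open>Coarseness is asserted from n = 5 on. For n = 4 the cells are four tetrahedra around the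
  segment from \<open>{a, z}\<close> to its complement, and this triangulation of the octahedron
  properly refines a split into two square pyramids.\<close>

theorem theorem4p4:
  fixes v :: "nat \<Rightarrow> real ^ ('n::{finite,linorder})"
    and lam :: "real ^ ('n::{finite,linorder}) \<Rightarrow> real"
    and n :: nat
  assumes n: "n = CARD('n)" "n \<ge> 4"
    and v_enum: "bij_betw v {1..n choose 2} (vertices (hypersimplex 2))"
    and v_desc: "\<And>i j. 1 \<le> i \<Longrightarrow> i < j \<Longrightarrow> j \<le> n choose 2 \<Longrightarrow> lex_less (v j) (v i)"
    and lam: "\<And>i. 1 \<le> i \<Longrightarrow> i \<le> n choose 2 \<Longrightarrow> lam (v i) = (if i \<le> n - 2 then 1 else 0)"
  shows "non_matroidal (regular_subdivision (hypersimplex 2) lam) \<and>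
         (n \<ge> 5 \<longrightarrow>
            coarsest_subdivision (hypersimplex 2) (regular_subdivision (hypersimplex 2) lam)) \<and>
         spread (regular_subdivision (hypersimplex 2) lam) = n"
proof -
  define a z :: 'n where "a = Min UNIV" and "z = Max UNIV"
  have a: "a \<le> i" and z: "i \<le> z" for i
    by (simp_all add: a_def z_def)
  have "a \<noteq> z"
  proof
    assume "a = z"
    then have "UNIV = {a}"
      using a z by (metis UNIV_eq_I insertI1 order_antisym)
    then have "CARD('n) = 1"
      by (metis card_1_singleton_iff One_nat_def)
    then show False
      using n by simp
  qed
  have lam_eq: "lam (char_vec X) = star_lift a z X" if "card X = 2" for X
    using lift_eq_star_lift[OF a z \<open>a \<noteq> z\<close> v_enum v_desc lam[unfolded n(1)] that] n(1) by blast
  have tight: "tight_sets (lam \<circ> char_vec) = tight_sets (star_lift a z)"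
    by (rule tight_sets_affine[of 1 _ _ "\<lambda>_. 0"]) (simp_all add: lam_eq)
  have card4: "CARD('n) \<ge> 4"
    using n by simp
  have "cell (pyramid a z) \<in> regular_subdivision (hypersimplex 2) lam"
    using tight_sets_star_lift(1)[OF \<open>a \<noteq> z\<close>] by (simp add: regular_subdivision_hypersimplex tight)
  then have "non_matroidal (regular_subdivision (hypersimplex 2) lam)"
    unfolding non_matroidal_def using non_matroidal_pyramid[OF \<open>a \<noteq> z\<close> card4] by blast
  moreover have "n \<ge> 5 \<longrightarrow>
      coarsest_subdivision (hypersimplex 2) (regular_subdivision (hypersimplex 2) lam)"
    using coarsest_star_lift[OF \<open>a \<noteq> z\<close> _ lam_eq] n(1) by blast
  moreover have "spread (regular_subdivision (hypersimplex 2) lam) = n"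
    using spread_star_lift[OF \<open>a \<noteq> z\<close> card4 tight] n(1) by simp
  ultimately show ?thesis
    by blast
qed

end
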